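(* Let $\gamma>0$. The functions $G,H:L^2(\Omega)\to\mathbb{R}$ defined by $$G(u)=\frac12\|Su+Sf-y_d\|^2_{L^2(\Omega)}+\frac{\alpha}{2}\|u\|^2_{L^2(\Omega)}+\beta\delta_\gamma\|u\|_{L^1(\Omega)},\qquad H(u)=\beta\big(\delta_\gamma\|u\|_{L^1(\Omega)}-\Upsilon_{p,\gamma}(u)\big)$$ are convex.
   Context: Let $\Omega\subset\mathbb{R}^n$ ($n=2$ or $n=3$) be a bounded Lipschitz domain with boundary $\Gamma$, let $p>1$, $\alpha>0$, $\beta>0$, and $f,y_d\in L^2(\Omega)$. Let $A$ be the differential operator $(Ay)(x)=-\sum_{i,j=1}^n\frac{\partial}{\partial x_i}\big(a_{ij}(x)\frac{\partial y(x)}{\partial x_j}\big)+c_0\,y(x)$ with $a_{ij}\in C^{0,1}(\bar\Omega)$, $c_0\in L^\infty(\Omega)$, $(a_{ij})$ symmetric, and such that there is $\sigma>0$ with $\sum_{i,j}a_{ij}(x)\xi_i\xi_j\ge\sigma|\xi|^2$ for all $\xi\in\mathbb{R}^n$ and almost all $x\in\Omega$. Put $a(y,v)=\int_\Omega \sum_{i,j}a_{ij}\frac{\partial y}{\partial x_j}\frac{\partial v}{\partial x_i}+c_0yv\,dx$. It is a standing assumption that for each $w\in L^2(\Omega)$ there is a unique $y\in H_0^1(\Omega)$ with $a(y,v)=(w,v)_{L^2(\Omega)}$ for all $v\in H_0^1(\Omega)$, and that the linear map $S:L^2(\Omega)\to H_0^1(\Omega)$, $w\mapsto y$, is continuous.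 For $\gamma>0$ define $h_{p,\gamma}:\mathbb{R}\to\mathbb{R}$ by $h_{p,\gamma}(v)=\frac{\gamma^{p-1}}{p}|v|^p$ if $|v|\le\frac1\gamma$ and $h_{p,\gamma}(v)=|v|+\frac1\gamma\frac{1-p}{p}$ otherwise; $\Upsilon_{p,\gamma}(u)=\int_\Omega h_{p,\gamma}(u(x))^{1/p}\,dx$; and $\delta_\gamma=\gamma^{\frac{p-1}{p}}/p^{\frac1p}$. *)

theory Defs
  imports "HOL-Analysis.Analysis" "HOL-Library.Function_Algebras"
begin

text \<open>Pointwise real vector space structure on functions, so that the library's
  \<^const>\<open>convex_on\<close> applies to functionals on spaces of real-valued functions.\<close>

instantiation "fun" :: (type, real_vector) real_vector
begin

definition scaleR_fun :: "real \<Rightarrow> ('a \<Rightarrow> 'b) \<Rightarrow> 'a \<Rightarrow> 'b"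
  where "scaleR_fun r f = (\<lambda>x. r *\<^sub>R f x)"

instance
  by standard (simp_all add: scaleR_fun_def fun_eq_iff scaleR_add_right scaleR_add_left)

end

text \<open>The defining condition at a boundary point says that, in the coordinates given by a unit
  vector \<open>e\<close> and its orthogonal complement, \<open>\<Omega>\<close> is locally the part of space lying strictly
  above the graph of a Lipschitz function \<open>g\<close> on the hyperplane orthogonal to \<open>e\<close>.\<close>

definition Lipschitz_boundary :: "(real^'n) set \<Rightarrow> bool"
  where "Lipschitz_boundary \<Omega> \<longleftrightarrow>
    (\<forall>x0 \<in> frontier \<Omega>. \<exists>e r L. \<exists>g :: real^'n \<Rightarrow> real.
       norm e = 1 \<and> r > 0 \<and> L-lipschitz_on {z. z \<bullet> e = 0} g \<and>
       (\<forall>x \<in> ball x0 r. x \<in> \<Omega> \<longleftrightarrow> x \<bullet> e > g (x - (x \<bullet> e) *\<^sub>R e)))"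

definition bounded_Lipschitz_domain :: "(real^'n) set \<Rightarrow> bool"
  where "bounded_Lipschitz_domain \<Omega> \<longleftrightarrow>
    open \<Omega> \<and> connected \<Omega> \<and> \<Omega> \<noteq> {} \<and> bounded \<Omega> \<and> Lipschitz_boundary \<Omega>"

text \<open>Elements of the function spaces on \<open>\<Omega>\<close> are represented by functions on the whole space
  whose values outside \<open>\<Omega>\<close> are irrelevant; equality in these spaces is equality almost
  everywhere on \<open>\<Omega>\<close>, and all norms and integrals below only depend on the equivalence class.\<close>

definition L2 :: "(real^'n) set \<Rightarrow> (real^'n \<Rightarrow> real) set"
  where "L2 \<Omega> = {u \<in> borel_measurable (lebesgue_on \<Omega>). integrable (lebesgue_on \<Omega>) (\<lambda>x. (u x)\<^sup>2)}"

definition Linfty :: "(real^'n) set \<Rightarrow> (real^'n \<Rightarrow> real) set"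
  where "Linfty \<Omega> =
    {u \<in> borel_measurable (lebesgue_on \<Omega>). \<exists>M. AE x in lebesgue_on \<Omega>. \<bar>u x\<bar> \<le> M}"

definition L2_inner :: "(real^'n) set \<Rightarrow> (real^'n \<Rightarrow> real) \<Rightarrow> (real^'n \<Rightarrow> real) \<Rightarrow> real"
  where "L2_inner \<Omega> u v = (\<integral>x. u x * v x \<partial>lebesgue_on \<Omega>)"

definition L2_norm :: "(real^'n) set \<Rightarrow> (real^'n \<Rightarrow> real) \<Rightarrow> real"
  where "L2_norm \<Omega> u = sqrt (\<integral>x. (u x)\<^sup>2 \<partial>lebesgue_on \<Omega>)"

definition L1_norm :: "(real^'n) set \<Rightarrow> (real^'n \<Rightarrow> real) \<Rightarrow> real"
  where "L1_norm \<Omega> u = (\<integral>x. \<bar>u x\<bar> \<partial>lebesgue_on \<Omega>)"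

definition partial :: "'n \<Rightarrow> (real^'n \<Rightarrow> real) \<Rightarrow> real^'n \<Rightarrow> real"
  where "partial i f x = frechet_derivative f (at x) (axis i 1)"

primrec Ck :: "nat \<Rightarrow> (real^'n \<Rightarrow> real) \<Rightarrow> bool" where
  "Ck 0 f \<longleftrightarrow> continuous_on UNIV f"
| "Ck (Suc k) f \<longleftrightarrow> f differentiable_on UNIV \<and> (\<forall>i. Ck k (partial i f))"

text \<open>\<open>C\<^sub>c\<^sup>\<infinity>(\<Omega>)\<close>, its elements being extended by zero to the whole space.\<close>

definition test_functions :: "(real^'n) set \<Rightarrow> (real^'n \<Rightarrow> real) set"
  where "test_functions \<Omega> =
    {\<phi>. (\<forall>k. Ck k \<phi>) \<and> compact (closure {x. \<phi> x \<noteq> 0}) \<and> closure {x. \<phi> x \<noteq> 0} \<subseteq> \<Omega>}"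

definition has_weak_partial ::
    "(real^'n) set \<Rightarrow> 'n \<Rightarrow> (real^'n \<Rightarrow> real) \<Rightarrow> (real^'n \<Rightarrow> real) \<Rightarrow> bool"
  where "has_weak_partial \<Omega> i y g \<longleftrightarrow>
    g \<in> L2 \<Omega> \<and> (\<forall>\<phi> \<in> test_functions \<Omega>. L2_inner \<Omega> y (partial i \<phi>) = - L2_inner \<Omega> g \<phi>)"

text \<open>The weak derivative is unique up to equality almost everywhere on \<open>\<Omega>\<close>;
  a representative is chosen.\<close>

definition weak_partial :: "(real^'n) set \<Rightarrow> 'n \<Rightarrow> (real^'n \<Rightarrow> real) \<Rightarrow> real^'n \<Rightarrow> real"
  where "weak_partial \<Omega> i y = (SOME g. has_weak_partial \<Omega> i y g)"

definition H1 :: "(real^'n) set \<Rightarrow> (real^'n \<Rightarrow> real) set"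
  where "H1 \<Omega> = {y \<in> L2 \<Omega>. \<forall>i. \<exists>g. has_weak_partial \<Omega> i y g}"

definition H1_norm :: "(real^'n) set \<Rightarrow> (real^'n \<Rightarrow> real) \<Rightarrow> real"
  where "H1_norm \<Omega> y = sqrt ((L2_norm \<Omega> y)\<^sup>2 + (\<Sum>i\<in>UNIV. (L2_norm \<Omega> (weak_partial \<Omega> i y))\<^sup>2))"

text \<open>The closure of the test functions in \<open>H\<^sup>1(\<Omega>)\<close>. The weak derivatives of a
  test function are its classical ones, which are used here directly.\<close>

definition H10 :: "(real^'n) set \<Rightarrow> (real^'n \<Rightarrow> real) set"
  where "H10 \<Omega> = {y \<in> H1 \<Omega>. \<forall>\<epsilon>>0. \<exists>\<phi> \<in> test_functions \<Omega>.
    sqrt ((L2_norm \<Omega> (y - \<phi>))\<^sup>2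
      + (\<Sum>i\<in>UNIV. (L2_norm \<Omega> (weak_partial \<Omega> i y - partial i \<phi>))\<^sup>2)) < \<epsilon>}"

definition energy_form ::
    "(real^'n) set \<Rightarrow> ('n \<Rightarrow> 'n \<Rightarrow> real^'n \<Rightarrow> real) \<Rightarrow> (real^'n \<Rightarrow> real)
      \<Rightarrow> (real^'n \<Rightarrow> real) \<Rightarrow> (real^'n \<Rightarrow> real) \<Rightarrow> real"
  where "energy_form \<Omega> a c0 y v =
    (\<integral>x. (\<Sum>i\<in>UNIV. \<Sum>j\<in>UNIV. a i j x * weak_partial \<Omega> j y x * weak_partial \<Omega> i v x)
         + c0 x * y x * v x \<partial>lebesgue_on \<Omega>)"

definition weak_solution ::
    "(real^'n) set \<Rightarrow> ('n \<Rightarrow> 'n \<Rightarrow> real^'n \<Rightarrow> real) \<Rightarrow> (real^'n \<Rightarrow> real)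
      \<Rightarrow> (real^'n \<Rightarrow> real) \<Rightarrow> (real^'n \<Rightarrow> real) \<Rightarrow> bool"
  where "weak_solution \<Omega> a c0 w y \<longleftrightarrow>
    y \<in> H10 \<Omega> \<and> (\<forall>v \<in> H10 \<Omega>. energy_form \<Omega> a c0 y v = L2_inner \<Omega> w v)"

text \<open>\<open>S\<close> maps every \<open>w \<in> L\<^sup>2(\<Omega>)\<close> to a representative of the weak solution, which exists
  and is unique almost everywhere on \<open>\<Omega>\<close>.\<close>

definition solution_operator ::
    "(real^'n) set \<Rightarrow> ('n \<Rightarrow> 'n \<Rightarrow> real^'n \<Rightarrow> real) \<Rightarrow> (real^'n \<Rightarrow> real)
      \<Rightarrow> ((real^'n \<Rightarrow> real) \<Rightarrow> (real^'n \<Rightarrow> real)) \<Rightarrow> bool"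
  where "solution_operator \<Omega> a c0 S \<longleftrightarrow>
    (\<forall>w \<in> L2 \<Omega>. weak_solution \<Omega> a c0 w (S w) \<and>
       (\<forall>y. weak_solution \<Omega> a c0 w y \<longrightarrow> (AE x in lebesgue_on \<Omega>. y x = S w x)))"

definition continuous_L2_H1 ::
    "(real^'n) set \<Rightarrow> ((real^'n \<Rightarrow> real) \<Rightarrow> (real^'n \<Rightarrow> real)) \<Rightarrow> bool"
  where "continuous_L2_H1 \<Omega> S \<longleftrightarrow>
    (\<forall>w \<in> L2 \<Omega>. \<forall>\<epsilon>>0. \<exists>\<delta>>0. \<forall>w' \<in> L2 \<Omega>.
       L2_norm \<Omega> (w' - w) < \<delta> \<longrightarrow> H1_norm \<Omega> (S w' - S w) < \<epsilon>)"

definition h_reg :: "real \<Rightarrow> real \<Rightarrow> real \<Rightarrow> real"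
  where "h_reg p \<gamma> v =
    (if \<bar>v\<bar> \<le> 1 / \<gamma> then \<gamma> powr (p - 1) / p * \<bar>v\<bar> powr p
     else \<bar>v\<bar> + 1 / \<gamma> * ((1 - p) / p))"

definition Upsilon :: "(real^'n) set \<Rightarrow> real \<Rightarrow> real \<Rightarrow> (real^'n \<Rightarrow> real) \<Rightarrow> real"
  where "Upsilon \<Omega> p \<gamma> u = (\<integral>x. h_reg p \<gamma> (u x) powr (1 / p) \<partial>lebesgue_on \<Omega>)"

definition delta :: "real \<Rightarrow> real \<Rightarrow> real"
  where "delta p \<gamma> = \<gamma> powr ((p - 1) / p) / p powr (1 / p)"

end

(* S is linear almost everywhere: H10 is a subspace and the energy form is linear in its first
   argument because weak partial derivatives are unique up to null sets, which is the fundamental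
   lemma of the calculus of variations, proved with products of the smooth functions
   exp (- c / (x - p)) * exp (- c / (q - x)), which tend to indicator functions of boxes as c
   tends to 0. So G is a sum of convex functionals.  For H, the scalar function
   delta * |v| - h(v)^(1/p) vanishes for |v| <= 1 / gamma and continues beyond that point with
   matching value 0 and slope 0 as a convex function of |v|. *)
theory Submission
  imports Defs
begin

text \<open>Functions stand for their classes, and passing between the two needs an argument each
  time. \<open>S w\<close> is some representative and \<open>solution_operator\<close> does not
  mention linearity, so convex combinations go through the variational equation and return by its
  uniqueness clause. \<open>weak_partial\<close> is chosen separately for each function, so even its
  additivity holds only off a null set. Bochner integrals default to 0, so splitting or comparing
  them requires integrability first. The constant \<open>delta p \<gamma>\<close> is forced twice:
  for \<open>\<bar>v\<bar> \<le> 1 / \<gamma>\<close> the p-th root of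
  \<open>h_reg p \<gamma> v\<close> is exactly \<open>delta p \<gamma> * \<bar>v\<bar>\<close>, and
  the slope of the outer branch of this root at 1 / \<gamma> is (1/p) (p \<gamma>)^(1 - 1/p), the
  same number. Subtracting the root therefore removes the corner at 0 and creates no concave kink at
  1 / \<gamma>.\<close>

section \<open>Classical partial derivatives and the classes \<open>Ck\<close>\<close>

lemma partial_eq:
  assumes "(f has_derivative f') (at x)"
  shows "partial i f x = f' (axis i 1)"
  using frechet_derivative_at[OF assms] by (simp add: partial_def)

lemma differentiable_on_UNIV_has_derivative:
  "f differentiable_on UNIV \<Longrightarrow> (f has_derivative frechet_derivative f (at x)) (at x)"
  by (simp add: differentiable_on_def frechet_derivative_works)

lemma partial_add:
  assumes "f differentiable_on UNIV" "g differentiable_on UNIV"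
  shows "partial i (\<lambda>x. f x + g x) = (\<lambda>x. partial i f x + partial i g x)"
proof
  fix x
  show "partial i (\<lambda>x. f x + g x) x = partial i f x + partial i g x"
    using partial_eq[OF has_derivative_add[OF assms[THEN differentiable_on_UNIV_has_derivative]]]
    by (simp add: partial_def)
qed

lemma partial_scale:
  assumes "f differentiable_on UNIV"
  shows "partial i (\<lambda>x. c * f x) = (\<lambda>x. c * partial i f x)"
proof
  fix x
  show "partial i (\<lambda>x. c * f x) x = c * partial i f x"
    using partial_eq[OF has_derivative_mult_right[OF assms[THEN differentiable_on_UNIV_has_derivative]]]
    by (simp add: partial_def)
qed

lemma partial_mult:
  assumes "f differentiable_on UNIV" "g differentiable_on UNIV"
  shows "partial i (\<lambda>x. f x * g x) = (\<lambda>x. f x * partial i g x + partial i f x * g x)"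
proof
  fix x
  show "partial i (\<lambda>x. f x * g x) x = f x * partial i g x + partial i f x * g x"
    using partial_eq[OF has_derivative_mult[OF assms[THEN differentiable_on_UNIV_has_derivative]]]
    by (simp add: partial_def)
qed

text \<open>Needed for the product rule, where each term keeps one factor undifferentiated.\<close>

lemma Ck_SucD: "Ck (Suc k) f \<Longrightarrow> Ck k f"
proof (induction k arbitrary: f)
  case 0
  then show ?case by (simp add: differentiable_imp_continuous_on)
next
  case (Suc k)
  from Suc.prems Suc.IH show ?case by (auto simp only: Ck.simps(2))
qed

lemma Ck_add: "Ck k f \<Longrightarrow> Ck k g \<Longrightarrow> Ck k (\<lambda>x. f x + g x)"
  by (induction k arbitrary: f g) (simp_all add: continuous_on_add partial_add differentiable_on_add)

lemma Ck_const: "Ck k (\<lambda>x::real^'n. c)"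
proof (induction k arbitrary: c)
  case (Suc k)
  have "partial i (\<lambda>x::real^'n. c) = (\<lambda>x. 0)" for i
    using partial_eq[OF has_derivative_const] by blast
  then show ?case using Suc by simp
qed simp

lemma differentiable_on_mult_real:
  fixes f g :: "'a::real_normed_vector \<Rightarrow> real"
  assumes "f differentiable_on S" "g differentiable_on S"
  shows "(\<lambda>x. f x * g x) differentiable_on S"
  using assms by (auto simp: differentiable_on_def)

lemma Ck_mult: "Ck k f \<Longrightarrow> Ck k g \<Longrightarrow> Ck k (\<lambda>x. f x * g x)"
proof (induction k arbitrary: f g)
  case 0
  then show ?case by (simp add: continuous_on_mult)
next
  case (Suc k)
  then have "f differentiable_on UNIV" "g differentiable_on UNIV" by simp_all
  moreover have "Ck k f" "Ck k g" using Suc.prems Ck_SucD by blast+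
  ultimately show ?case
    using Suc.prems by (simp add: partial_mult differentiable_on_mult_real Ck_add Suc.IH)
qed

lemma Ck_prod:
  assumes "finite A" "\<And>i. i \<in> A \<Longrightarrow> Ck k (f i)"
  shows "Ck k (\<lambda>x. \<Prod>i\<in>A. f i x)"
  using assms by (induction A rule: finite_induct) (auto simp: Ck_const Ck_mult)

section \<open>Smooth bump functions on boxes\<close>

text \<open>The classical function exp (- c / x), extended by 0 to x <= 0. The extra powers of 1 / x
  make the family closed under differentiation up to linear combinations, so smoothness follows by
  one induction.\<close>

definition flat :: "real \<Rightarrow> nat \<Rightarrow> real \<Rightarrow> real"
  where "flat c k x = (if x > 0 then (1 / x) ^ k * exp (- c / x) else 0)"

lemma power_times_exp_tendsto_0:
  assumes "c > (0::real)"
  shows "((\<lambda>y. y ^ k * exp (- c * y)) \<longlongrightarrow> 0) at_top"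
proof -
  have "filterlim (\<lambda>y. c * y) at_top at_top"
    using assms by (simp add: filterlim_tendsto_pos_mult_at_top[OF tendsto_const] filterlim_ident)
  from filterlim_compose[OF tendsto_power_div_exp_0 this]
  have "((\<lambda>y. 1 / c ^ k * ((c * y) ^ k / exp (c * y))) \<longlongrightarrow> 1 / c ^ k * 0) at_top"
    by (intro tendsto_mult tendsto_const)
  moreover have "1 / c ^ k * ((c * y) ^ k / exp (c * y)) = y ^ k * exp (- c * y)" for y
    using assms by (simp add: power_mult_distrib exp_minus field_simps)
  ultimately show ?thesis by simp
qed

lemma flat_has_derivative:
  assumes c: "c > 0"
  shows "(flat c k has_real_derivative c * flat c (k + 2) x - real k * flat c (k + 1) x) (at x)"
proof (cases x "0::real" rule: linorder_cases)
  case less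
  have "((\<lambda>_. 0) has_real_derivative 0) (at x)" by simp
  then have "(flat c k has_real_derivative 0) (at x)"
    by (rule DERIV_cong_ev[THEN iffD1, rotated 3])
      (use less in \<open>auto simp: flat_def intro!: eventually_mono[OF eventually_nhds_in_open[of "{..<0}"]]\<close>)
  then show ?thesis using less by (simp add: flat_def)
next
  case greater
  have "((\<lambda>x. 1 / x) has_real_derivative - ((1 / x)\<^sup>2)) (at x)"
    and "((\<lambda>x. exp (- c / x)) has_real_derivative exp (- c / x) * (c * (1 / x)\<^sup>2)) (at x)"
    using greater by (auto intro!: derivative_eq_intros simp: field_simps power2_eq_square)
  from DERIV_mult[OF DERIV_power[OF this(1), of k] this(2)]
  have "((\<lambda>x. (1 / x) ^ k * exp (- c / x)) has_real_derivative
      c * ((1 / x) ^ (k + 2) * exp (- c / x)) - real k * ((1 / x) ^ (k + 1) * exp (- c / x))) (at x)"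
    \<comment> \<open>The power rule produces the exponent k - 1 with truncated subtraction, so k =
      0 is a separate case.\<close>
    by (rule DERIV_cong) (cases k; simp add: algebra_simps power2_eq_square del: power_one_over power_divide)
  then have "((\<lambda>x. (1 / x) ^ k * exp (- c / x)) has_real_derivative
      c * flat c (k + 2) x - real k * flat c (k + 1) x) (at x)"
    using greater by (simp only: flat_def if_True)
  then show ?thesis
    by (rule DERIV_cong_ev[THEN iffD1, rotated 3])
      (use greater in \<open>auto simp: flat_def intro!: eventually_mono[OF eventually_nhds_in_open[of "{0<..}"]]\<close>)
next
  case equal
  have "((\<lambda>y. flat c k y / y) \<longlongrightarrow> 0) (at_right 0)"
  proof (rule Lim_transform_eventually)
    \<comment> \<open>The difference quotient at 0 gains one more power of 1 / y; substituting t = 1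
      / y turns it into a power of t times exp (- c t).\<close>
    show "((\<lambda>y. (1 / y) ^ Suc k * exp (- c * (1 / y))) \<longlongrightarrow> 0) (at_right (0::real))"
      using filterlim_compose[OF power_times_exp_tendsto_0[OF c, of "Suc k"] filterlim_inverse_at_top_right]
      by (simp add: inverse_eq_divide)
    show "\<forall>\<^sub>F y in at_right 0. (1 / y) ^ Suc k * exp (- c * (1 / y)) = flat c k y / y"
      by (auto simp: eventually_at_right_field flat_def intro!: exI[of _ 1])
  qed
  moreover have "((\<lambda>y. flat c k y / y) \<longlongrightarrow> 0) (at_left 0)"
    by (rule Lim_transform_eventually[of "\<lambda>_. 0"])
      (auto simp: eventually_at_left_field flat_def intro!: exI[of _ "-1"])
  ultimately have "((\<lambda>y. flat c k y / y) \<longlongrightarrow> 0) (at 0)"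
    by (simp add: filterlim_at_split)
  then show ?thesis
    using equal by (simp add: has_field_derivative_iff flat_def)
qed

text \<open>The parameters \<open>s\<close> and \<open>d\<close> cover both kinds of factor in
  \<open>bump\<close>, increasing and decreasing in the coordinate. The index \<open>k\<close> must
  vary in the induction because differentiation raises it.\<close>

lemma Ck_flat_component:
  fixes i :: "'n::finite"
  assumes c: "c > 0"
  shows "Ck n (\<lambda>x::real^'n. flat c k (s * x $ i + d))"
proof (induction n arbitrary: k)
  have D: "((\<lambda>x::real^'n. flat c k (s * x $ i + d)) has_derivative
      (\<lambda>h. (s * h $ i) * (c * flat c (k + 2) (s * x $ i + d) - real k * flat c (k + 1) (s * x $ i + d)))) (at x)"
    for k x
    by (rule DERIV_compose_FDERIV[OF flat_has_derivative[OF c]])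
      (auto intro!: derivative_eq_intros bounded_linear_imp_has_derivative bounded_linear_vec_nth)
  { case 0
    show ?case
      using has_derivative_continuous[OF D] by (auto simp: continuous_on_eq_continuous_at) }
  { case (Suc n)
    have "partial j (\<lambda>x::real^'n. flat c k (s * x $ i + d)) =
       (\<lambda>x. (s * axis j 1 $ i) * (c * flat c (k + 2) (s * x $ i + d) + (- real k) * flat c (k + 1) (s * x $ i + d)))" for j
      using partial_eq[OF D] by auto
    moreover have "(\<lambda>x::real^'n. flat c k (s * x $ i + d)) differentiable_on UNIV"
      using D by (auto simp: differentiable_on_def differentiable_def)
    moreover have "Ck n (\<lambda>x. (s * axis j 1 $ i) *
        (c * flat c (k + 2) (s * x $ i + d) + (- real k) * flat c (k + 1) (s * x $ i + d)))" for j
      by (intro Ck_mult Ck_const Ck_add Suc)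
    ultimately show ?case
      by (simp only: Ck.simps(2)) simp }
qed

text \<open>For c > 0 this is positive exactly on the open box. Every factor stays in [0, 1] and
  tends to 1 inside as c tends to 0, so indicators of boxes are dominated limits of test functions
  and no convolution is involved.\<close>

definition bump :: "real \<Rightarrow> real^'n \<Rightarrow> real^'n \<Rightarrow> real^'n \<Rightarrow> real"
  where "bump c p q x = (\<Prod>i\<in>UNIV. flat c 0 (x $ i - p $ i) * flat c 0 (q $ i - x $ i))"

lemma Ck_bump: "c > 0 \<Longrightarrow> Ck n (bump c p q)"
  unfolding bump_def
  using Ck_flat_component[of c n 0 1 _ "- p $ _"] Ck_flat_component[of c n 0 "-1"]
  by (auto intro!: Ck_prod Ck_mult)

lemma flat_0_bounds: "c > 0 \<Longrightarrow> 0 \<le> flat c 0 x" "c > 0 \<Longrightarrow> flat c 0 x \<le> 1"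
  by (auto simp: flat_def divide_le_0_iff)

lemma bump_nonneg: "c > 0 \<Longrightarrow> 0 \<le> bump c p q x"
  by (simp add: bump_def prod_nonneg flat_0_bounds)

lemma bump_le_1: "c > 0 \<Longrightarrow> bump c p q x \<le> 1"
  by (auto simp: bump_def flat_0_bounds intro!: prod_le_1 mult_le_one)

lemma bump_eq_0: "x \<notin> box p q \<Longrightarrow> bump c p q x = 0"
  by (auto simp: bump_def mem_box_cart flat_def)

lemma bump_test_function:
  assumes "c > 0" "cbox p q \<subseteq> \<Omega>"
  shows "bump c p q \<in> test_functions \<Omega>"
proof -
  have sub: "{x. bump c p q x \<noteq> 0} \<subseteq> cbox p q"
    using bump_eq_0[of _ p q c] box_subset_cbox[of p q] by blast
  then have "closure {x. bump c p q x \<noteq> 0} \<subseteq> cbox p q"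
    by (simp add: closure_minimal[OF _ closed_cbox])
  then show ?thesis
    using assms bounded_subset[OF bounded_cbox sub]
    by (auto simp: test_functions_def Ck_bump)
qed

lemma bump_tendsto_indicator:
  assumes "c \<longlonglongrightarrow> 0" "\<And>m. c m > 0"
  shows "(\<lambda>m. bump (c m) p q x) \<longlonglongrightarrow> indicator (box p q) x"
proof (cases "x \<in> box p q")
  case True
  have E: "(\<lambda>m. flat (c m) 0 t) \<longlonglongrightarrow> 1" if "t > 0" for t
  proof -
    have "(\<lambda>m. exp (- c m / t)) \<longlonglongrightarrow> exp (- 0 / t)"
      using that by (intro tendsto_intros assms) auto
    then show ?thesis using that by (simp add: flat_def)
  qed
  have "(\<lambda>m. bump (c m) p q x) \<longlonglongrightarrow> (\<Prod>i::'a\<in>UNIV. 1 * 1)"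
    unfolding bump_def using True by (intro tendsto_prod tendsto_mult E) (auto simp: mem_box_cart)
  then show ?thesis using True by simp
qed (simp add: bump_eq_0)

section \<open>The fundamental lemma of the calculus of variations\<close>

lemma sigma_finite_measure_lebesgue: "sigma_finite_measure lebesgue"
proof
  obtain A :: "'a set set" where A: "countable A" "A \<subseteq> sets lborel" "\<Union>A = space lborel"
      "\<And>a. a \<in> A \<Longrightarrow> emeasure lborel a \<noteq> \<infinity>"
    using lborel.sigma_finite_countable by metis
  then show "\<exists>A::'a set set. countable A \<and> A \<subseteq> sets lebesgue \<and> \<Union>A = space lebesgue \<and>
      (\<forall>a\<in>A. emeasure lebesgue a \<noteq> \<infinity>)"
    by (intro exI[of _ A]) auto
qed

text \<open>Open boxes are an intersection-stable generator of the Borel sets, so a Dynkin argument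
  extends the vanishing of the integral to all Borel sets. A Lebesgue set differs from a Borel set
  by a null set, and a function whose integral over every measurable set is 0 vanishes almost
  everywhere.\<close>

lemma AE_eq_0_if_box_integrals_0:
  fixes f :: "'a::euclidean_space \<Rightarrow> real"
  assumes f: "integrable lebesgue f"
    and box: "\<And>a b. (\<integral>x. indicator (box a b) x * f x \<partial>lebesgue) = 0"
  shows "AE x in lebesgue. f x = 0"
proof (rule sigma_finite_measure.density_zero[OF _ f])
  show "sigma_finite_measure (lebesgue :: 'a measure)"
    by (rule sigma_finite_measure_lebesgue)
  have int: "integrable lebesgue (\<lambda>x. indicator A x * f x)" if "A \<in> sets lebesgue" for A
    using integrable_mult_indicator[OF that f] by simp
  have le: "norm (indicator A x * f x) \<le> norm (f x)" for A x
    by (cases "x \<in> A") auto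
  \<comment> \<open>Closure under complements needs the integral over the whole space, which is
    exhausted by the cubes with corners -n and n.\<close>
  have UNIV: "(\<integral>x. f x \<partial>lebesgue) = 0"
  proof -
    have "(\<lambda>n. \<integral>x. indicator (box (- real n *\<^sub>R One) (real n *\<^sub>R One)) x * f x \<partial>lebesgue) \<longlonglongrightarrow> (\<integral>x. f x \<partial>lebesgue)"
    proof (rule integral_dominated_convergence[where w="\<lambda>x. norm (f x)"])
      show "AE x in lebesgue. (\<lambda>n. indicator (box (- real n *\<^sub>R One) (real n *\<^sub>R One)) x * f x) \<longlonglongrightarrow> f x"
      proof (rule AE_I2, rule tendsto_eventually)
        fix x :: 'a
        obtain N :: nat where "norm x < real N" using reals_Archimedean2 by blast
        then have "x \<in> box (- real n *\<^sub>R One) (real n *\<^sub>R One)" if "n \<ge> N" for n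
        proof -
          have "\<bar>x \<bullet> b\<bar> < real n" if "b \<in> Basis" for b
            using Basis_le_norm[OF that, of x] \<open>norm x < real N\<close> \<open>n \<ge> N\<close> by linarith
          then show ?thesis by (force simp: mem_box abs_less_iff)
        qed
        then show "\<forall>\<^sub>F n in sequentially. indicator (box (- real n *\<^sub>R One) (real n *\<^sub>R One)) x * f x = f x"
          by (intro eventually_sequentiallyI[of N]) simp
      qed
      show "(\<lambda>x. indicator (box (- real n *\<^sub>R One) (real n *\<^sub>R One)) x * f x) \<in> borel_measurable lebesgue" for n
        by (rule borel_measurable_integrable[OF int]) simp
      show "AE x in lebesgue. norm (indicator (box (- real n *\<^sub>R One) (real n *\<^sub>R One)) x * f x) \<le> norm (f x)" for n
        by (rule AE_I2, rule le)
    qed (rule borel_measurable_integrable[OF f] integrable_norm[OF f])+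
    then have "(\<lambda>n. 0) \<longlonglongrightarrow> (\<integral>x. f x \<partial>lebesgue)" by (simp only: box)
    then show ?thesis using LIMSEQ_unique[OF tendsto_const] by metis
  qed
  have borel: "(\<integral>x. indicator A x * f x \<partial>lebesgue) = 0" if "A \<in> sets borel" for A
  proof -
    have sigma: "sigma_sets UNIV (range (\<lambda>(a, b). box a b :: 'a set)) = sets borel"
      by (subst borel_eq_box) simp
    have "Int_stable (range (\<lambda>(a, b). box a b :: 'a set))"
      by (auto simp: Int_stable_def box_Int_box)
    moreover have "range (\<lambda>(a, b). box a b :: 'a set) \<subseteq> Pow UNIV" by simp
    moreover have "A \<in> sigma_sets UNIV (range (\<lambda>(a, b). box a b))"
      using that by (simp only: sigma)
    ultimately show ?thesis
    proof (induction A rule: sigma_sets_induct_disjoint)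
      case (compl A)
      then have "A \<in> sets lebesgue" by (simp add: sigma)
      have "(\<integral>x. indicator (UNIV - A) x * f x \<partial>lebesgue) = (\<integral>x. f x - indicator A x * f x \<partial>lebesgue)"
        by (rule Bochner_Integration.integral_cong) (auto simp: indicator_def)
      then show ?case
        using compl UNIV int[OF \<open>A \<in> sets lebesgue\<close>] f by simp
    next
      case (union A)
      from union(2) have "range A \<subseteq> sets borel" by (simp only: sigma)
      from subsetD[OF this rangeI] have A: "A i \<in> sets lebesgue" for i by simp
      have "set_lebesgue_integral lebesgue (\<Union>i. A i) f = (\<Sum>i. set_lebesgue_integral lebesgue (A i) f)"
      proof (rule lebesgue_integral_countable_add)
        show "A i \<inter> A j = {}" if "i \<noteq> j" for i j
          using union(1) that by (auto simp: disjoint_family_on_def)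
        show "set_integrable lebesgue (\<Union>i. A i) f"
          using int[of "\<Union>i. A i"] A by (simp add: set_integrable_def sets.countable_UN)
      qed (rule A)
      then show ?case using union(3) by (simp add: set_lebesgue_integral_def)
    qed (use box in auto)
  qed
  fix A :: "'a set"
  assume "A \<in> sets lebesgue"
  then obtain S N N' where A: "A = S \<union> N" "N \<subseteq> N'" "N' \<in> null_sets lborel" "S \<in> sets lborel"
    by (rule sets_completionE)
  then have "AE x in lborel. x \<notin> N"
    by (intro eventually_mono[OF AE_not_in[of N' lborel]]) auto
  then have "AE x in lebesgue. x \<notin> N" by (rule AE_completion)
  then have "AE x in lebesgue. indicator A x * f x = indicator S x * f x"
    by (rule AE_mp) (auto simp: A(1) indicator_def)
  then have "(\<integral>x. indicator A x * f x \<partial>lebesgue) = (\<integral>x. indicator S x * f x \<partial>lebesgue)"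
    using A \<open>A \<in> sets lebesgue\<close> int by (intro integral_cong_AE) (auto intro: borel_measurable_integrable)
  then show "set_lebesgue_integral lebesgue A f = 0"
    using A borel by (simp add: set_lebesgue_integral_def)
qed

text \<open>Limits of \<open>bump\<close> functions give zero integrals only over boxes whose
  closure lies in \<Omega>. The global criterion is therefore applied to the function cut off by one
  such box, and \<Omega> is then covered by countably many closed boxes, whose faces are null
  sets.\<close>

lemma AE_eq_0_if_test_integrals_0:
  fixes d :: "real^'n \<Rightarrow> real"
  assumes "open \<Omega>" and d: "integrable (lebesgue_on \<Omega>) d"
    and test: "\<And>\<phi>. \<phi> \<in> test_functions \<Omega> \<Longrightarrow> L2_inner \<Omega> d \<phi> = 0"
  shows "AE x in lebesgue_on \<Omega>. d x = 0"
proof -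
  have [simp]: "\<Omega> \<inter> space lebesgue \<in> sets lebesgue" "\<Omega> \<in> sets lebesgue"
    using \<open>open \<Omega>\<close> by auto
  define F where "F x = indicator \<Omega> x * d x" for x
  have F: "integrable lebesgue F"
    using d by (simp add: integrable_restrict_space F_def[abs_def])
  have [measurable]: "F \<in> borel_measurable lebesgue" "box p q \<in> sets lebesgue" for p q :: "real^'n"
    using F by (auto intro: borel_measurable_integrable)
  have box: "(\<integral>x. indicator (box p q) x * F x \<partial>lebesgue) = 0" if "cbox p q \<subseteq> \<Omega>" for p q
  proof -
    define c where "c m = 1 / real (Suc m)" for m
    have c: "c \<longlonglongrightarrow> 0" "\<And>m. c m > 0"
      using LIMSEQ_inverse_real_of_nat by (simp_all add: c_def[abs_def] inverse_eq_divide)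
    have [measurable]: "bump (c m) p q \<in> borel_measurable lebesgue" for m
    proof -
      have "continuous_on UNIV (bump (c m) p q)"
        using Ck_bump[OF c(2), of 0] by simp
      then show ?thesis
        by (simp add: borel_measurable_continuous_onI measurable_completion)
    qed
    have "(\<lambda>m. \<integral>x. bump (c m) p q x * F x \<partial>lebesgue) \<longlonglongrightarrow> (\<integral>x. indicator (box p q) x * F x \<partial>lebesgue)"
    proof (rule integral_dominated_convergence[where w="\<lambda>x. norm (F x)"])
      show "AE x in lebesgue. (\<lambda>m. bump (c m) p q x * F x) \<longlonglongrightarrow> indicator (box p q) x * F x"
        by (intro AE_I2 tendsto_mult bump_tendsto_indicator c tendsto_const)
      show "AE x in lebesgue. norm (bump (c m) p q x * F x) \<le> norm (F x)" for m
        by (intro AE_I2)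
          (simp add: abs_mult bump_nonneg[OF c(2)] bump_le_1[OF c(2)] mult_left_le_one_le)
    qed (use F in auto)
    moreover have zero: "(\<integral>x. bump (c m) p q x * F x \<partial>lebesgue) = 0" for m
      using test[OF bump_test_function[OF c(2) that]]
      by (simp add: L2_inner_def integral_restrict_space F_def mult_ac)
    ultimately have "(\<lambda>m. 0) \<longlonglongrightarrow> (\<integral>x. indicator (box p q) x * F x \<partial>lebesgue)" by (simp only: zero)
    then show ?thesis using LIMSEQ_unique[OF tendsto_const] by metis
  qed
  have cbox: "AE x in lebesgue. x \<in> cbox p q \<longrightarrow> F x = 0" if "cbox p q \<subseteq> \<Omega>" for p q
  proof -
    have "AE x in lebesgue. indicator (box p q) x * F x = 0"
    proof (rule AE_eq_0_if_box_integrals_0)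
      show "integrable lebesgue (\<lambda>x. indicator (box p q) x * F x)"
        using integrable_mult_indicator[OF _ F, of "box p q"] by simp
      fix a b :: "real^'n"
      \<comment> \<open>A nonempty open box has the closed box as its closure, which places
        \<open>cbox p' q'\<close> inside \<open>cbox p q\<close>. For an empty intersection the
        reversed corners 1 and 0 make both boxes empty.\<close>
      obtain p' q' where pq: "box a b \<inter> box p q = box p' q'" and cb: "cbox p' q' \<subseteq> \<Omega>"
      proof (cases "box a b \<inter> box p q = {}")
        case True
        have *: "box 1 (0::real^'n) = {}" "cbox 1 (0::real^'n) = {}"
          unfolding interval_eq_empty_cart by (simp_all only: one_index zero_index) auto
        show thesis
          by (rule that[of 1 0, unfolded True *]) (rule refl empty_subsetI)+
      next
        case False
        obtain p' q' where pq: "box a b \<inter> box p q = box p' q'"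
          unfolding box_Int_box by blast
        with False have "cbox p' q' = closure (box a b \<inter> box p q)" by (simp add: closure_box)
        also have "\<dots> \<subseteq> cbox p q"
          using box_subset_cbox[of p q] by (intro closure_minimal closed_cbox) blast
        finally show thesis using that pq \<open>cbox p q \<subseteq> \<Omega>\<close> by blast
      qed
      have "(\<integral>x. indicator (box a b) x * (indicator (box p q) x * F x) \<partial>lebesgue) =
        (\<integral>x. indicator (box p' q') x * F x \<partial>lebesgue)"
        by (simp only: pq[symmetric] indicator_inter_arith mult.assoc)
      then show "(\<integral>x. indicator (box a b) x * (indicator (box p q) x * F x) \<partial>lebesgue) = 0"
        using box[OF cb] by simp
    qed
    moreover have "AE x in lebesgue. x \<notin> cbox p q - box p q"
      using negligible_frontier_interval[of p q] by (intro AE_not_in) (simp add: negligible_iff_null_sets)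
    ultimately show ?thesis by eventually_elim auto
  qed
  obtain D where D: "countable D" "D \<subseteq> Pow \<Omega>" "\<And>X. X \<in> D \<Longrightarrow> \<exists>a b. X = cbox a b" "\<Union>D = \<Omega>"
    using open_countable_Union_open_cbox[OF \<open>open \<Omega>\<close>] by metis
  have "AE x in lebesgue. \<forall>X\<in>D. x \<in> X \<longrightarrow> F x = 0"
  proof (subst AE_ball_countable)
    show "\<forall>X\<in>D. AE x in lebesgue. x \<in> X \<longrightarrow> F x = 0"
    proof
      fix X assume "X \<in> D"
      then obtain p q where "X = cbox p q" "X \<subseteq> \<Omega>" using D by blast
      then show "AE x in lebesgue. x \<in> X \<longrightarrow> F x = 0" using cbox by simp
    qed
  qed (rule D)
  then have "AE x in lebesgue. x \<in> \<Omega> \<longrightarrow> d x = 0"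
  proof eventually_elim
    case (elim x)
    then have "x \<in> \<Omega> \<longrightarrow> F x = 0" using D(4) by blast
    then show ?case by (auto simp: F_def)
  qed
  then show ?thesis by (simp add: AE_restrict_space_iff)
qed

section \<open>The scalar defect of the regularised root\<close>

text \<open>The shift in \<^term>\<open>M\<close> makes its graph touch the horizontal axis at \<open>1 / \<gamma>\<close> tangentially.\<close>

lemma h_reg_defect_eq:
  fixes p \<gamma> :: real
  assumes p: "p > 1" and \<gamma>: "\<gamma> > 0"
  defines "M \<equiv> \<lambda>r. delta p \<gamma> * r - (r - (p - 1) / (p * \<gamma>)) powr (1 / p)"
  shows "delta p \<gamma> * \<bar>v\<bar> - h_reg p \<gamma> v powr (1 / p) = M (max \<bar>v\<bar> (1 / \<gamma>))"
    and "\<exists>M' M''. (\<forall>r \<ge> 1 / \<gamma>. (M has_real_derivative M' r) (at r) \<and>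
       (M' has_real_derivative M'' r) (at r) \<and> M' r \<ge> 0 \<and> M'' r \<ge> 0)"
proof -
  \<comment> \<open>The base of the power at the touching point; its positivity keeps
    \<open>M\<close> smooth on the whole half-line from 1 / \<gamma>.\<close>
  have c: "1 / \<gamma> - (p - 1) / (p * \<gamma>) = 1 / (p * \<gamma>)"
    using p \<gamma> by (simp add: field_simps)
  have pp: "p powr (1 / p - 1) = p powr (1/p) / p" "\<gamma> powr ((p - 1) / p) = \<gamma> / \<gamma> powr (1 / p)"
    using p \<gamma> by (simp_all add: powr_diff diff_divide_distrib)
  have M0: "M (1 / \<gamma>) = 0"
    using p \<gamma> by (simp add: M_def c delta_def pp powr_divide powr_mult)
  have small: "h_reg p \<gamma> v powr (1 / p) = delta p \<gamma> * \<bar>v\<bar>" if "\<bar>v\<bar> \<le> 1 / \<gamma>"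
    using p \<gamma> that by (simp add: h_reg_def delta_def powr_mult powr_divide powr_powr)
  show "delta p \<gamma> * \<bar>v\<bar> - h_reg p \<gamma> v powr (1 / p) = M (max \<bar>v\<bar> (1 / \<gamma>))"
  proof (cases "\<bar>v\<bar> \<le> 1 / \<gamma>")
    case True
    then show ?thesis using M0 small by (simp add: max_def)
  next
    case False
    have "\<bar>v\<bar> + 1 / \<gamma> * ((1 - p) / p) = \<bar>v\<bar> - (p - 1) / (p * \<gamma>)"
      using p \<gamma> by (simp add: field_simps)
    then show ?thesis using False by (simp add: h_reg_def M_def max_def)
  qed
  define M' where "M' r = delta p \<gamma> - 1 / p * (r - (p - 1) / (p * \<gamma>)) powr (1 / p - 1)" for r
  define M'' where "M'' r = - (1 / p * ((1 / p - 1) * (r - (p - 1) / (p * \<gamma>)) powr (1 / p - 1 - 1)))" for r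
  \<comment> \<open>Both parts of the slope at the touching point reduce to the same product of
    powers of p and \<gamma>, so they cancel.\<close>
  have "(1 / (p * \<gamma>)) powr (1 / p - 1) = (p * \<gamma>) powr (1 - 1 / p)"
    using powr_minus[of "1 / (p * \<gamma>)" "1 - 1 / p"] powr_divide[of 1 "p * \<gamma>" "1 - 1 / p"] p \<gamma>
    by (simp add: inverse_eq_divide)
  then have "M' (1 / \<gamma>) = 0"
    using p \<gamma> by (simp only: M'_def c delta_def pp) (simp add: powr_mult powr_diff)
  show "\<exists>M' M''. (\<forall>r \<ge> 1 / \<gamma>. (M has_real_derivative M' r) (at r) \<and>
       (M' has_real_derivative M'' r) (at r) \<and> M' r \<ge> 0 \<and> M'' r \<ge> 0)"
  proof (intro exI allI impI conjI)
    fix r assume r: "r \<ge> 1 / \<gamma>"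
    have "1 / (p * \<gamma>) > 0" using p \<gamma> by simp
    then have pos: "r - (p - 1) / (p * \<gamma>) > 0" using c r by linarith
    show "(M has_real_derivative M' r) (at r)"
      unfolding M_def M'_def using pos p by (auto intro!: derivative_eq_intros)
    show "(M' has_real_derivative M'' r) (at r)"
      unfolding M'_def M''_def using pos p by (auto intro!: derivative_eq_intros)
    show "M'' r \<ge> 0"
      using p by (auto simp: M''_def intro!: divide_nonpos_nonneg mult_nonpos_nonneg)
    \<comment> \<open>The exponent 1 / p - 1 is negative, so the power decreases in r and the slope
      can only grow from its value 0 at 1 / \<gamma>.\<close>
    have "(r - (p - 1) / (p * \<gamma>)) powr (1 / p - 1) \<le> (1 / \<gamma> - (p - 1) / (p * \<gamma>)) powr (1 / p - 1)"
      using p \<gamma> r c pos by (intro powr_mono2') auto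
    then have "M' (1 / \<gamma>) \<le> M' r"
      using p unfolding M'_def by (intro diff_left_mono mult_left_mono) auto
    then show "M' r \<ge> 0" using \<open>M' (1 / \<gamma>) = 0\<close> by simp
  qed
qed

text \<open>A nondecreasing convex function composed with a convex one is convex; the inner function
  is the maximum of |v| and 1 / \<gamma>, which never leaves the half-line where \<open>M\<close> is
  controlled. Monotonicity also yields the pointwise bound, which later serves as an integrable
  majorant.\<close>

lemma h_reg_defect_convex:
  assumes p: "p > 1" and \<gamma>: "\<gamma> > 0"
  shows "convex_on UNIV (\<lambda>v. delta p \<gamma> * \<bar>v\<bar> - h_reg p \<gamma> v powr (1 / p))"
    and "h_reg p \<gamma> v powr (1 / p) \<le> delta p \<gamma> * \<bar>v\<bar>"
proof -
  define M where "M r = delta p \<gamma> * r - (r - (p - 1) / (p * \<gamma>)) powr (1 / p)" for r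
  have eq: "delta p \<gamma> * \<bar>v\<bar> - h_reg p \<gamma> v powr (1 / p) = M (max \<bar>v\<bar> (1 / \<gamma>))" for v
    using h_reg_defect_eq(1)[OF p \<gamma>] by (simp add: M_def)
  obtain M' M'' where M: "\<And>r. r \<ge> 1 / \<gamma> \<Longrightarrow> (M has_real_derivative M' r) (at r)"
     "\<And>r. r \<ge> 1 / \<gamma> \<Longrightarrow> (M' has_real_derivative M'' r) (at r)" "\<And>r. r \<ge> 1 / \<gamma> \<Longrightarrow> M' r \<ge> 0" "\<And>r. r \<ge> 1 / \<gamma> \<Longrightarrow> M'' r \<ge> 0"
    using h_reg_defect_eq(2)[OF p \<gamma>] unfolding M_def[abs_def, symmetric] by metis
  have mono: "M r \<le> M s" if "1 / \<gamma> \<le> r" "r \<le> s" for r s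
    using that M by (intro DERIV_nonneg_imp_nondecreasing[of r s M]) (meson order_trans)+
  have conv: "convex_on {1 / \<gamma>..} M"
    by (rule f''_ge0_imp_convex[of _ _ M' M'']) (use M in auto)
  show "convex_on UNIV (\<lambda>v. delta p \<gamma> * \<bar>v\<bar> - h_reg p \<gamma> v powr (1 / p))"
    unfolding eq
  proof (rule convex_onI)
    fix t x y :: real
    assume t: "0 < t" "t < 1"
    let ?m = "\<lambda>v. max \<bar>v\<bar> (1 / \<gamma>)"
    have "\<bar>(1 - t) * x + t * y\<bar> \<le> (1 - t) * \<bar>x\<bar> + t * \<bar>y\<bar>"
      using t by (intro order_trans[OF abs_triangle_ineq]) (simp add: abs_mult)
    also have "\<dots> \<le> (1 - t) * ?m x + t * ?m y"
      using t by (intro add_mono mult_left_mono) auto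
    finally have 1: "\<bar>(1 - t) * x + t * y\<bar> \<le> (1 - t) * ?m x + t * ?m y" .
    have "1 / \<gamma> = (1 - t) * (1 / \<gamma>) + t * (1 / \<gamma>)"
      by (simp add: diff_divide_distrib)
    also have "\<dots> \<le> (1 - t) * ?m x + t * ?m y"
      using t by (intro add_mono mult_left_mono) auto
    finally have "?m ((1 - t) *\<^sub>R x + t *\<^sub>R y) \<le> (1 - t) * ?m x + t * ?m y"
      using 1 by simp
    then have "M (?m ((1 - t) *\<^sub>R x + t *\<^sub>R y)) \<le> M ((1 - t) * ?m x + t * ?m y)"
      by (intro mono) auto
    also have "\<dots> \<le> (1 - t) * M (?m x) + t * M (?m y)"
      using convex_onD[OF conv, of t "?m x" "?m y"] t by simp
    finally show "M (?m ((1 - t) *\<^sub>R x + t *\<^sub>R y)) \<le> (1 - t) * M (?m x) + t * M (?m y)" .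
  qed simp
  \<comment> \<open>The value of \<open>M\<close> at 1 / \<gamma> is read off at v = 0, where both
    terms of the defect vanish.\<close>
  have "M (max \<bar>0\<bar> (1 / \<gamma>)) = 0"
    using p \<gamma> unfolding eq[symmetric] by (simp add: h_reg_def)
  then have "0 \<le> M (max \<bar>v\<bar> (1 / \<gamma>))"
    using mono[of "1 / \<gamma>" "max \<bar>v\<bar> (1 / \<gamma>)"] \<gamma> by simp
  then show "h_reg p \<gamma> v powr (1 / p) \<le> delta p \<gamma> * \<bar>v\<bar>"
    using eq[of v] by simp
qed

section \<open>Square-integrable functions and convex integral functionals\<close>

lemma minus_fun_lincomb:
  fixes u v u' v' :: "'a \<Rightarrow> real"
  shows "(\<lambda>x. a * u x + b * v x) - (\<lambda>x. a * u' x + b * v' x) = (\<lambda>x. a * (u - u') x + b * (v - v') x)"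
  by (simp add: fun_eq_iff algebra_simps)

text \<open>The gap between the two sides is the square of a s - b t. This crude bound stands in for
  the triangle inequality, since approximation arguments tolerate a constant factor.\<close>

lemma power2_lincomb_le: "(a * s + b * t)\<^sup>2 \<le> 2 * a\<^sup>2 * s\<^sup>2 + 2 * b\<^sup>2 * t\<^sup>2" for a b s t :: real
  using zero_le_power2[of "a * s - b * t"] by (simp add: power2_eq_square algebra_simps)

text \<open>Openness makes the domain measurable and admits the fundamental lemma; boundedness makes
  its measure finite and its closure compact.\<close>

locale bounded_open =
  fixes \<Omega> :: "(real^'n) set"
  assumes open_dom: "open \<Omega>" and bounded_dom: "bounded \<Omega>"
begin

lemma sets_dom: "\<Omega> \<in> sets lebesgue"
  using open_dom by auto

lemma finite_measure_dom: "finite_measure (lebesgue_on \<Omega>)"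
  using open_dom bounded_dom by (intro finite_measure_lebesgue_on lmeasurable_open)

lemma L2_measurable: "u \<in> L2 \<Omega> \<Longrightarrow> u \<in> borel_measurable (lebesgue_on \<Omega>)"
  by (simp add: L2_def)

lemma L2_integrable_power2: "u \<in> L2 \<Omega> \<Longrightarrow> integrable (lebesgue_on \<Omega>) (\<lambda>x. (u x)\<^sup>2)"
  by (simp add: L2_def)

lemma L2_mult_integrable:
  assumes u: "u \<in> L2 \<Omega>" and v: "v \<in> L2 \<Omega>"
  shows "integrable (lebesgue_on \<Omega>) (\<lambda>x. u x * v x)"
proof (rule Bochner_Integration.integrable_bound)
  show "integrable (lebesgue_on \<Omega>) (\<lambda>x. (u x)\<^sup>2 + (v x)\<^sup>2)"
    using u v by (intro Bochner_Integration.integrable_add L2_integrable_power2)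
  show "(\<lambda>x. u x * v x) \<in> borel_measurable (lebesgue_on \<Omega>)"
    using u v by (intro borel_measurable_times L2_measurable)
  have "\<bar>s * t\<bar> \<le> s\<^sup>2 + t\<^sup>2" for s t :: real
  proof -
    have "0 \<le> (\<bar>s\<bar> - \<bar>t\<bar>)\<^sup>2" by simp
    then have "2 * \<bar>s * t\<bar> \<le> s\<^sup>2 + t\<^sup>2"
      by (simp add: power2_diff abs_mult)
    then show ?thesis using abs_ge_zero[of "s * t"] by linarith
  qed
  then show "AE x in lebesgue_on \<Omega>. norm (u x * v x) \<le> norm ((u x)\<^sup>2 + (v x)\<^sup>2)"
    by (intro AE_I2) simp
qed

lemma L2_lincomb:
  assumes u: "u \<in> L2 \<Omega>" and v: "v \<in> L2 \<Omega>"
  shows "(\<lambda>x. a * u x + b * v x) \<in> L2 \<Omega>"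
proof -
  have "integrable (lebesgue_on \<Omega>) (\<lambda>x. a\<^sup>2 * (u x)\<^sup>2 + b\<^sup>2 * (v x)\<^sup>2 + 2 * a * b * (u x * v x))"
    using u v by (intro Bochner_Integration.integrable_add integrable_mult_right
        L2_integrable_power2 L2_mult_integrable)
  also have "(\<lambda>x. a\<^sup>2 * (u x)\<^sup>2 + b\<^sup>2 * (v x)\<^sup>2 + 2 * a * b * (u x * v x)) = (\<lambda>x. (a * u x + b * v x)\<^sup>2)"
    by (simp add: power2_sum power_mult_distrib algebra_simps)
  finally have "integrable (lebesgue_on \<Omega>) (\<lambda>x. (a * u x + b * v x)\<^sup>2)" .
  moreover have "(\<lambda>x. a * u x + b * v x) \<in> borel_measurable (lebesgue_on \<Omega>)"
    by (intro borel_measurable_add borel_measurable_times borel_measurable_const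
        L2_measurable[OF u] L2_measurable[OF v])
  ultimately show ?thesis by (simp add: L2_def)
qed

lemma L2_add: "u \<in> L2 \<Omega> \<Longrightarrow> v \<in> L2 \<Omega> \<Longrightarrow> u + v \<in> L2 \<Omega>"
  using L2_lincomb[of u v 1 1] by (simp add: plus_fun_def)

lemma L2_diff: "u \<in> L2 \<Omega> \<Longrightarrow> v \<in> L2 \<Omega> \<Longrightarrow> u - v \<in> L2 \<Omega>"
  using L2_lincomb[of u v 1 "-1"] by (simp add: fun_diff_def)

lemma continuous_L2:
  assumes "continuous_on UNIV g"
  shows "g \<in> L2 \<Omega>"
proof -
  have m: "g \<in> borel_measurable (lebesgue_on \<Omega>)"
    using continuous_on_subset[OF assms subset_UNIV] sets_dom
    by (rule continuous_imp_measurable_on_sets_lebesgue)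
  have "compact (g ` closure \<Omega>)"
    using assms bounded_dom by (intro compact_continuous_image) (auto intro: continuous_on_subset)
  then have "bounded (g ` closure \<Omega>)" by (rule compact_imp_bounded)
  then obtain K where K: "\<And>x. x \<in> closure \<Omega> \<Longrightarrow> \<bar>g x\<bar> \<le> K"
    by (auto simp: bounded_iff)
  have "(g x)\<^sup>2 \<le> K\<^sup>2" if "x \<in> \<Omega>" for x
    using K[of x] that closure_subset[of \<Omega>] power_mono[of "\<bar>g x\<bar>" K 2] by auto
  then have "integrable (lebesgue_on \<Omega>) (\<lambda>x. (g x)\<^sup>2)"
    using m by (intro finite_measure.integrable_const_bound[OF finite_measure_dom, of _ "K\<^sup>2"] AE_I2) auto
  with m show ?thesis by (simp add: L2_def)
qed

text \<open>Pairing with the constant 1, which is square-integrable because \<Omega> has finite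
  measure.\<close>

lemma L2_integrable: "u \<in> L2 \<Omega> \<Longrightarrow> integrable (lebesgue_on \<Omega>) u"
  using L2_mult_integrable[of u "\<lambda>_. 1"] continuous_L2[of "\<lambda>_. 1"] by simp

lemma Linfty_mult_integrable:
  assumes c: "c \<in> Linfty \<Omega>" and u: "u \<in> L2 \<Omega>" and v: "v \<in> L2 \<Omega>"
  shows "integrable (lebesgue_on \<Omega>) (\<lambda>x. c x * u x * v x)"
proof -
  obtain K where K: "AE x in lebesgue_on \<Omega>. \<bar>c x\<bar> \<le> K" and m: "c \<in> borel_measurable (lebesgue_on \<Omega>)"
    using c by (auto simp: Linfty_def)
  show ?thesis
  proof (rule Bochner_Integration.integrable_bound)
    show "integrable (lebesgue_on \<Omega>) (\<lambda>x. K * (u x * v x))"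
      using u v by (intro integrable_mult_right L2_mult_integrable)
    show "(\<lambda>x. c x * u x * v x) \<in> borel_measurable (lebesgue_on \<Omega>)"
      by (intro borel_measurable_times m L2_measurable[OF u] L2_measurable[OF v])
    show "AE x in lebesgue_on \<Omega>. norm (c x * u x * v x) \<le> norm (K * (u x * v x))"
      using K by eventually_elim (auto simp: abs_mult mult.assoc intro!: mult_right_mono)
  qed
qed

lemma Lipschitz_Linfty:
  assumes "L-lipschitz_on (closure \<Omega>) c"
  shows "c \<in> Linfty \<Omega>"
proof -
  have cont: "continuous_on (closure \<Omega>) c"
    using assms by (rule lipschitz_on_continuous_on)
  then have m: "c \<in> borel_measurable (lebesgue_on \<Omega>)"
    using continuous_imp_measurable_on_sets_lebesgue[OF continuous_on_subset[OF cont closure_subset] sets_dom] by simp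
  have "compact (c ` closure \<Omega>)"
    using cont bounded_dom by (intro compact_continuous_image) auto
  then have "bounded (c ` closure \<Omega>)" by (rule compact_imp_bounded)
  then obtain K where K: "\<And>x. x \<in> closure \<Omega> \<Longrightarrow> \<bar>c x\<bar> \<le> K"
    by (auto simp: bounded_iff)
  then have "AE x in lebesgue_on \<Omega>. \<bar>c x\<bar> \<le> K"
    using closure_subset[of \<Omega>] by (intro AE_I2) auto
  with m show ?thesis by (auto simp: Linfty_def)
qed

lemma L2_norm_power2: "(L2_norm \<Omega> u)\<^sup>2 = (\<integral>x. (u x)\<^sup>2 \<partial>lebesgue_on \<Omega>)"
  by (simp add: L2_norm_def)

lemma L2_norm_lincomb:
  assumes u: "u \<in> L2 \<Omega>" and v: "v \<in> L2 \<Omega>" and w: "w \<in> L2 \<Omega>"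
    and eq: "AE x in lebesgue_on \<Omega>. w x = a * u x + b * v x"
  shows "(L2_norm \<Omega> w)\<^sup>2 \<le> 2 * a\<^sup>2 * (L2_norm \<Omega> u)\<^sup>2 + 2 * b\<^sup>2 * (L2_norm \<Omega> v)\<^sup>2"
proof -
  have "(\<integral>x. (w x)\<^sup>2 \<partial>lebesgue_on \<Omega>) \<le> (\<integral>x. 2 * a\<^sup>2 * (u x)\<^sup>2 + 2 * b\<^sup>2 * (v x)\<^sup>2 \<partial>lebesgue_on \<Omega>)"
    using u v w eq by (intro integral_mono_AE Bochner_Integration.integrable_add integrable_mult_right
        L2_integrable_power2) (auto elim!: eventually_mono intro: power2_lincomb_le)
  also have "\<dots> = 2 * a\<^sup>2 * (\<integral>x. (u x)\<^sup>2 \<partial>lebesgue_on \<Omega>) + 2 * b\<^sup>2 * (\<integral>x. (v x)\<^sup>2 \<partial>lebesgue_on \<Omega>)"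
    using u v L2_integrable_power2 by simp
  finally show ?thesis by (simp add: L2_norm_power2)
qed

lemma convex_L2: "convex (L2 \<Omega>)"
  unfolding convex_def using L2_lincomb by (auto simp: plus_fun_def scaleR_fun_def)

text \<open>The pointwise convexity inequality is integrated. \<open>F\<close> is kept apart from
  the integral because a difference of functionals becomes a single integral only once both parts
  are integrable.\<close>

lemma convex_on_L2_integral:
  assumes k: "convex_on UNIV k"
    and int: "\<And>u. u \<in> L2 \<Omega> \<Longrightarrow> integrable (lebesgue_on \<Omega>) (\<lambda>x. k (u x))"
    and F: "\<And>u. u \<in> L2 \<Omega> \<Longrightarrow> F u = (\<integral>x. k (u x) \<partial>lebesgue_on \<Omega>)"
  shows "convex_on (L2 \<Omega>) F"
  unfolding convex_on_def
proof (intro conjI convex_L2 ballI allI impI)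
  fix u v and s t :: real
  assume uv: "u \<in> L2 \<Omega>" "v \<in> L2 \<Omega>" and st: "0 \<le> s" "0 \<le> t" "s + t = 1"
  have w: "s *\<^sub>R u + t *\<^sub>R v = (\<lambda>x. s * u x + t * v x)"
    by (simp add: fun_eq_iff scaleR_fun_def)
  have "(\<integral>x. k (s * u x + t * v x) \<partial>lebesgue_on \<Omega>) \<le> (\<integral>x. s * k (u x) + t * k (v x) \<partial>lebesgue_on \<Omega>)"
  proof (rule integral_mono)
    show "integrable (lebesgue_on \<Omega>) (\<lambda>x. k (s * u x + t * v x))"
      by (rule int[OF L2_lincomb[OF uv]])
    show "integrable (lebesgue_on \<Omega>) (\<lambda>x. s * k (u x) + t * k (v x))"
      by (intro Bochner_Integration.integrable_add integrable_mult_right int uv)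
    show "k (s * u x + t * v x) \<le> s * k (u x) + t * k (v x)" for x
      using k st by (auto simp: convex_on_def)
  qed
  also have "\<dots> = s * F u + t * F v"
    using int uv by (simp add: F)
  finally show "F (s *\<^sub>R u + t *\<^sub>R v) \<le> s * F u + t * F v"
    by (simp only: w F[OF L2_lincomb[OF uv]])
qed

section \<open>Weak derivatives and the subspace \<open>H10\<close>\<close>

lemma L2_inner_lincomb:
  assumes "u \<in> L2 \<Omega>" "v \<in> L2 \<Omega>" "w \<in> L2 \<Omega>"
  shows "L2_inner \<Omega> (\<lambda>x. a * u x + b * v x) w = a * L2_inner \<Omega> u w + b * L2_inner \<Omega> v w"
proof -
  have "L2_inner \<Omega> (\<lambda>x. a * u x + b * v x) w =
      (\<integral>x. a * (u x * w x) + b * (v x * w x) \<partial>lebesgue_on \<Omega>)"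
    by (simp add: L2_inner_def algebra_simps)
  then show ?thesis
    using assms L2_mult_integrable by (simp add: L2_inner_def)
qed

lemma test_functions_L2:
  assumes "\<phi> \<in> test_functions \<Omega>"
  shows "\<phi> \<in> L2 \<Omega>" "partial i \<phi> \<in> L2 \<Omega>"
proof -
  have "Ck 0 \<phi>" "Ck (Suc 0) \<phi>" using assms unfolding test_functions_def by blast+
  then show "\<phi> \<in> L2 \<Omega>" "partial i \<phi> \<in> L2 \<Omega>" by (auto intro: continuous_L2)
qed

lemma test_functions_lincomb:
  assumes \<phi>: "\<phi> \<in> test_functions \<Omega>" and \<psi>: "\<psi> \<in> test_functions \<Omega>"
  shows "(\<lambda>x. a * \<phi> x + b * \<psi> x) \<in> test_functions \<Omega>"
    and "partial i (\<lambda>x. a * \<phi> x + b * \<psi> x) = (\<lambda>x. a * partial i \<phi> x + b * partial i \<psi> x)"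
proof -
  have C: "Ck k \<phi>" "Ck k \<psi>" for k using \<phi> \<psi> unfolding test_functions_def by blast+
  have sub: "closure {x. a * \<phi> x + b * \<psi> x \<noteq> 0} \<subseteq> closure {x. \<phi> x \<noteq> 0} \<union> closure {x. \<psi> x \<noteq> 0}"
    unfolding closure_Un[symmetric] by (rule closure_mono) auto
  have supp: "compact (closure {x. \<phi> x \<noteq> 0})" "compact (closure {x. \<psi> x \<noteq> 0})"
      "closure {x. \<phi> x \<noteq> 0} \<subseteq> \<Omega>" "closure {x. \<psi> x \<noteq> 0} \<subseteq> \<Omega>"
    using \<phi> \<psi> unfolding test_functions_def by blast+
  have "compact (closure {x. a * \<phi> x + b * \<psi> x \<noteq> 0})"
    using compact_Int_closed[OF compact_Un[OF supp(1,2)] closed_closure[of "{x. a * \<phi> x + b * \<psi> x \<noteq> 0}"]]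
    by (simp only: inf.absorb2[OF sub])
  moreover have "closure {x. a * \<phi> x + b * \<psi> x \<noteq> 0} \<subseteq> \<Omega>"
    using sub supp(3,4) by (meson Un_least order_trans)
  moreover have "Ck k (\<lambda>x. a * \<phi> x + b * \<psi> x)" for k
    by (intro Ck_add Ck_mult Ck_const C)
  ultimately show "(\<lambda>x. a * \<phi> x + b * \<psi> x) \<in> test_functions \<Omega>"
    by (simp add: test_functions_def)
  have "\<phi> differentiable_on UNIV" "\<psi> differentiable_on UNIV" using C[of "Suc 0"] by auto
  then show "partial i (\<lambda>x. a * \<phi> x + b * \<psi> x) = (\<lambda>x. a * partial i \<phi> x + b * partial i \<psi> x)"
    by (simp add: partial_add partial_scale differentiable_on_mult_real)
qed

lemma has_weak_partial_lincomb:
  assumes y: "y \<in> L2 \<Omega>" "has_weak_partial \<Omega> i y g" and z: "z \<in> L2 \<Omega>" "has_weak_partial \<Omega> i z h"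
  shows "has_weak_partial \<Omega> i (\<lambda>x. a * y x + b * z x) (\<lambda>x. a * g x + b * h x)"
proof -
  have L2: "g \<in> L2 \<Omega>" "h \<in> L2 \<Omega>" using y z by (simp_all add: has_weak_partial_def)
  have "L2_inner \<Omega> (\<lambda>x. a * y x + b * z x) (partial i \<phi>) = - L2_inner \<Omega> (\<lambda>x. a * g x + b * h x) \<phi>"
    if \<phi>: "\<phi> \<in> test_functions \<Omega>" for \<phi>
  proof -
    have "L2_inner \<Omega> y (partial i \<phi>) = - L2_inner \<Omega> g \<phi>" "L2_inner \<Omega> z (partial i \<phi>) = - L2_inner \<Omega> h \<phi>"
      using y z \<phi> by (simp_all add: has_weak_partial_def)
    then show ?thesis
      unfolding L2_inner_lincomb[OF y(1) z(1) test_functions_L2(2)[OF \<phi>]]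
        L2_inner_lincomb[OF L2 test_functions_L2(1)[OF \<phi>]] by simp
  qed
  then show ?thesis
    using L2_lincomb[OF L2] by (simp add: has_weak_partial_def)
qed

text \<open>Both candidates have the same pairing with every test function, so their difference
  falls under the fundamental lemma.\<close>

lemma has_weak_partial_unique:
  assumes g: "has_weak_partial \<Omega> i y g" and h: "has_weak_partial \<Omega> i y h"
  shows "AE x in lebesgue_on \<Omega>. g x = h x"
proof -
  have L2: "g \<in> L2 \<Omega>" "h \<in> L2 \<Omega>" using g h by (auto simp: has_weak_partial_def)
  have "AE x in lebesgue_on \<Omega>. 1 * g x + (-1) * h x = 0"
  proof (rule AE_eq_0_if_test_integrals_0[OF open_dom])
    show "integrable (lebesgue_on \<Omega>) (\<lambda>x. 1 * g x + (-1) * h x)"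
      by (intro L2_integrable L2_lincomb L2)
    fix \<phi> assume \<phi>: "\<phi> \<in> test_functions \<Omega>"
    then have "L2_inner \<Omega> g \<phi> = L2_inner \<Omega> h \<phi>"
      using g h by (auto simp: has_weak_partial_def)
    then show "L2_inner \<Omega> (\<lambda>x. 1 * g x + (-1) * h x) \<phi> = 0"
      unfolding L2_inner_lincomb[OF L2 test_functions_L2(1)[OF \<phi>]] by simp
  qed
  then show ?thesis by eventually_elim simp
qed

lemma H1_L2: "y \<in> H1 \<Omega> \<Longrightarrow> y \<in> L2 \<Omega>"
  by (simp add: H1_def)

lemma has_weak_partial_weak_partial:
  assumes "y \<in> H1 \<Omega>"
  shows "has_weak_partial \<Omega> i y (weak_partial \<Omega> i y)"
proof -
  have "\<exists>g. has_weak_partial \<Omega> i y g" using assms by (simp add: H1_def)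
  then show ?thesis unfolding weak_partial_def by (rule someI_ex)
qed

lemma weak_partial_L2: "y \<in> H1 \<Omega> \<Longrightarrow> weak_partial \<Omega> i y \<in> L2 \<Omega>"
  using has_weak_partial_weak_partial[of y i] by (simp add: has_weak_partial_def)

lemma H1_lincomb:
  assumes y: "y \<in> H1 \<Omega>" and z: "z \<in> H1 \<Omega>"
  shows "(\<lambda>x. a * y x + b * z x) \<in> H1 \<Omega>"
  unfolding H1_def[of \<Omega>]
proof (intro CollectI conjI allI exI)
  show "(\<lambda>x. a * y x + b * z x) \<in> L2 \<Omega>"
    by (intro L2_lincomb H1_L2 y z)
  show "has_weak_partial \<Omega> i (\<lambda>x. a * y x + b * z x) (\<lambda>x. a * weak_partial \<Omega> i y x + b * weak_partial \<Omega> i z x)" for i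
    by (intro has_weak_partial_lincomb has_weak_partial_weak_partial H1_L2 y z)
qed

text \<open>Three unrelated choices of representative are compared: the combination of two of them
  is a weak derivative of the combined function, and uniqueness identifies it with the
  third.\<close>

lemma weak_partial_lincomb:
  assumes y: "y \<in> H1 \<Omega>" and z: "z \<in> H1 \<Omega>"
  shows "AE x in lebesgue_on \<Omega>. weak_partial \<Omega> i (\<lambda>x. a * y x + b * z x) x =
    a * weak_partial \<Omega> i y x + b * weak_partial \<Omega> i z x"
  using has_weak_partial_lincomb[OF H1_L2[OF y] has_weak_partial_weak_partial[OF y]
      H1_L2[OF z] has_weak_partial_weak_partial[OF z], of i a b]
  by (rule has_weak_partial_unique[OF has_weak_partial_weak_partial[OF H1_lincomb[OF y z]]])

lemma H10_H1: "y \<in> H10 \<Omega> \<Longrightarrow> y \<in> H1 \<Omega>"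
  by (simp add: H10_def)

text \<open>Approximating test functions of the two summands combine to one for the sum.
  \<open>Q\<close> is the squared distance, for which the factor-2 estimate applies to each term
  separately.\<close>

lemma H10_lincomb:
  assumes y: "y \<in> H10 \<Omega>" and z: "z \<in> H10 \<Omega>"
  shows "(\<lambda>x. a * y x + b * z x) \<in> H10 \<Omega>"
proof -
  define Q where "Q y \<phi> = (L2_norm \<Omega> (y - \<phi>))\<^sup>2
      + (\<Sum>i\<in>UNIV. (L2_norm \<Omega> (weak_partial \<Omega> i y - partial i \<phi>))\<^sup>2)" for y \<phi>
  have H10_iff: "u \<in> H10 \<Omega> \<longleftrightarrow> u \<in> H1 \<Omega> \<and> (\<forall>\<epsilon>>0. \<exists>\<phi> \<in> test_functions \<Omega>. sqrt (Q u \<phi>) < \<epsilon>)" for u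
    by (simp add: H10_def Q_def)
  note H1 = H10_H1[OF y] H10_H1[OF z]
  let ?w = "\<lambda>x. a * y x + b * z x"
  have Q: "Q ?w (\<lambda>x. a * \<phi> x + b * \<psi> x) \<le> 2 * a\<^sup>2 * Q y \<phi> + 2 * b\<^sup>2 * Q z \<psi>"
    if \<phi>: "\<phi> \<in> test_functions \<Omega>" and \<psi>: "\<psi> \<in> test_functions \<Omega>" for \<phi> \<psi>
  proof -
    note test = test_functions_L2[OF \<phi>] test_functions_L2[OF \<psi>]
    have "(L2_norm \<Omega> (?w - (\<lambda>x. a * \<phi> x + b * \<psi> x)))\<^sup>2 \<le>
        2 * a\<^sup>2 * (L2_norm \<Omega> (y - \<phi>))\<^sup>2 + 2 * b\<^sup>2 * (L2_norm \<Omega> (z - \<psi>))\<^sup>2"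
      unfolding minus_fun_lincomb
      by (intro L2_norm_lincomb L2_lincomb L2_diff H1_L2 H1 test AE_I2 refl)
    moreover have "(L2_norm \<Omega> (weak_partial \<Omega> i ?w - partial i (\<lambda>x. a * \<phi> x + b * \<psi> x)))\<^sup>2 \<le>
        2 * a\<^sup>2 * (L2_norm \<Omega> (weak_partial \<Omega> i y - partial i \<phi>))\<^sup>2
        + 2 * b\<^sup>2 * (L2_norm \<Omega> (weak_partial \<Omega> i z - partial i \<psi>))\<^sup>2" for i
    proof (rule L2_norm_lincomb)
      show "weak_partial \<Omega> i ?w - partial i (\<lambda>x. a * \<phi> x + b * \<psi> x) \<in> L2 \<Omega>"
        by (intro L2_diff weak_partial_L2 H1_lincomb H1 test_functions_L2 test_functions_lincomb \<phi> \<psi>)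
      show "AE x in lebesgue_on \<Omega>. (weak_partial \<Omega> i ?w - partial i (\<lambda>x. a * \<phi> x + b * \<psi> x)) x =
          a * (weak_partial \<Omega> i y - partial i \<phi>) x + b * (weak_partial \<Omega> i z - partial i \<psi>) x"
        using weak_partial_lincomb[OF H1, of i a b]
        by eventually_elim (simp add: test_functions_lincomb(2)[OF \<phi> \<psi>] algebra_simps)
    qed (intro L2_diff weak_partial_L2 H1 test)+
    then have "(\<Sum>i\<in>UNIV. (L2_norm \<Omega> (weak_partial \<Omega> i ?w - partial i (\<lambda>x. a * \<phi> x + b * \<psi> x)))\<^sup>2) \<le>
        2 * a\<^sup>2 * (\<Sum>i\<in>UNIV. (L2_norm \<Omega> (weak_partial \<Omega> i y - partial i \<phi>))\<^sup>2)
        + 2 * b\<^sup>2 * (\<Sum>i\<in>UNIV. (L2_norm \<Omega> (weak_partial \<Omega> i z - partial i \<psi>))\<^sup>2)"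
      unfolding sum_distrib_left sum.distrib[symmetric] by (rule sum_mono)
    ultimately show ?thesis by (simp add: Q_def algebra_simps)
  qed
  have "\<exists>\<phi> \<in> test_functions \<Omega>. sqrt (Q ?w \<phi>) < \<epsilon>" if "\<epsilon> > 0" for \<epsilon>
  proof -
    \<comment> \<open>With accuracy \<epsilon> / (2 K) for both summands the squared distance is at
      most \<epsilon>^2 / 2; the summand 1 keeps K positive when a and b vanish.\<close>
    define K where "K = 1 + \<bar>a\<bar> + \<bar>b\<bar>"
    have "K > 0" by (simp add: K_def)
    then have "\<epsilon> / (2 * K) > 0" using that by simp
    then obtain \<phi> \<psi> where \<phi>: "\<phi> \<in> test_functions \<Omega>" "sqrt (Q y \<phi>) < \<epsilon> / (2 * K)"
      and \<psi>: "\<psi> \<in> test_functions \<Omega>" "sqrt (Q z \<psi>) < \<epsilon> / (2 * K)"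
      using y z unfolding H10_iff by meson
    have pos: "0 \<le> Q u \<phi>" for u \<phi> by (simp add: Q_def sum_nonneg)
    have small: "Q y \<phi> \<le> (\<epsilon> / (2 * K))\<^sup>2" "Q z \<psi> \<le> (\<epsilon> / (2 * K))\<^sup>2"
      using \<phi>(2) \<psi>(2) pos by (auto intro: sqrt_le_D less_imp_le)
    have "Q ?w (\<lambda>x. a * \<phi> x + b * \<psi> x) \<le> 2 * a\<^sup>2 * Q y \<phi> + 2 * b\<^sup>2 * Q z \<psi>"
      by (rule Q[OF \<phi>(1) \<psi>(1)])
    also have "\<dots> \<le> 2 * a\<^sup>2 * (\<epsilon> / (2 * K))\<^sup>2 + 2 * b\<^sup>2 * (\<epsilon> / (2 * K))\<^sup>2"
      using small by (intro add_mono mult_left_mono) auto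
    also have "\<dots> = 2 * (a\<^sup>2 + b\<^sup>2) * (\<epsilon> / (2 * K))\<^sup>2"
      by (simp add: algebra_simps)
    also have "\<dots> \<le> 2 * K\<^sup>2 * (\<epsilon> / (2 * K))\<^sup>2"
    proof -
      have "a\<^sup>2 + b\<^sup>2 \<le> (\<bar>a\<bar> + \<bar>b\<bar>)\<^sup>2" by (simp add: power2_sum)
      also have "\<dots> \<le> K\<^sup>2" by (intro power_mono) (auto simp: K_def)
      finally show ?thesis by (intro mult_right_mono) auto
    qed
    also have "\<dots> = \<epsilon>\<^sup>2 / 2" using \<open>K > 0\<close> by (simp add: power2_eq_square)
    also have "\<dots> < \<epsilon>\<^sup>2" using that by simp
    finally have "sqrt (Q ?w (\<lambda>x. a * \<phi> x + b * \<psi> x)) < \<epsilon>"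
      using that real_less_lsqrt by simp
    then show ?thesis using test_functions_lincomb(1)[OF \<phi>(1) \<psi>(1)] by blast
  qed
  then show ?thesis using H1_lincomb[OF H1] unfolding H10_iff by blast
qed

section \<open>Linearity of the energy form and of the solution operator\<close>

context
  fixes a :: "'n \<Rightarrow> 'n \<Rightarrow> real^'n \<Rightarrow> real" and c0 :: "real^'n \<Rightarrow> real"
  assumes a: "\<And>i j. a i j \<in> Linfty \<Omega>" and c0: "c0 \<in> Linfty \<Omega>"
begin

lemma energy_form_integrable:
  assumes "y \<in> H1 \<Omega>" "v \<in> H1 \<Omega>"
  shows "integrable (lebesgue_on \<Omega>)
    (\<lambda>x. (\<Sum>i\<in>UNIV. \<Sum>j\<in>UNIV. a i j x * weak_partial \<Omega> j y x * weak_partial \<Omega> i v x) + c0 x * y x * v x)"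
  using assms by (intro Bochner_Integration.integrable_add Bochner_Integration.integrable_sum
      Linfty_mult_integrable a c0 weak_partial_L2 H1_L2)

lemma energy_form_lincomb:
  assumes y: "y \<in> H1 \<Omega>" and z: "z \<in> H1 \<Omega>" and v: "v \<in> H1 \<Omega>"
  shows "energy_form \<Omega> a c0 (\<lambda>x. s * y x + t * z x) v =
    s * energy_form \<Omega> a c0 y v + t * energy_form \<Omega> a c0 z v"
proof -
  let ?e = "\<lambda>y x. (\<Sum>i\<in>UNIV. \<Sum>j\<in>UNIV. a i j x * weak_partial \<Omega> j y x * weak_partial \<Omega> i v x) + c0 x * y x * v x"
  note int = energy_form_integrable[OF _ v]
  \<comment> \<open>One null set per coordinate; finitely many of them are merged before the
    integrands are compared.\<close>
  have "AE x in lebesgue_on \<Omega>. \<forall>j\<in>UNIV. weak_partial \<Omega> j (\<lambda>x. s * y x + t * z x) x =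
      s * weak_partial \<Omega> j y x + t * weak_partial \<Omega> j z x"
    by (intro AE_finite_allI weak_partial_lincomb y z) simp
  then have "AE x in lebesgue_on \<Omega>. ?e (\<lambda>x. s * y x + t * z x) x = s * ?e y x + t * ?e z x"
  proof eventually_elim
    case (elim x)
    show ?case
      by (simp only: elim[rule_format, OF UNIV_I] ring_distribs sum.distrib sum_distrib_left) (simp add: mult_ac add_ac)
  qed
  then have "energy_form \<Omega> a c0 (\<lambda>x. s * y x + t * z x) v = (\<integral>x. s * ?e y x + t * ?e z x \<partial>lebesgue_on \<Omega>)"
    unfolding energy_form_def
    by (rule integral_cong_AE[rotated 2])
      (intro borel_measurable_integrable Bochner_Integration.integrable_add integrable_mult_right int H1_lincomb y z)+
  also have "\<dots> = (\<integral>x. s * ?e y x \<partial>lebesgue_on \<Omega>) + (\<integral>x. t * ?e z x \<partial>lebesgue_on \<Omega>)"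
    by (intro Bochner_Integration.integral_add integrable_mult_right int y z)
  also have "\<dots> = s * energy_form \<Omega> a c0 y v + t * energy_form \<Omega> a c0 z v"
    by (simp only: energy_form_def integral_mult_right_zero)
  finally show ?thesis .
qed

lemma solution_operator_L2: "solution_operator \<Omega> a c0 S \<Longrightarrow> w \<in> L2 \<Omega> \<Longrightarrow> S w \<in> L2 \<Omega>"
  by (auto simp: solution_operator_def weak_solution_def intro: H1_L2 H10_H1)

text \<open>The combination of the two solutions solves the problem with the combined right-hand
  side, so the uniqueness clause of \<open>solution_operator\<close> applies to it.\<close>

lemma solution_operator_lincomb:
  assumes S: "solution_operator \<Omega> a c0 S" and u: "u \<in> L2 \<Omega>" and v: "v \<in> L2 \<Omega>"
  shows "AE x in lebesgue_on \<Omega>. S (\<lambda>x. s * u x + t * v x) x = s * S u x + t * S v x"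
proof -
  have sol: "weak_solution \<Omega> a c0 u (S u)" "weak_solution \<Omega> a c0 v (S v)"
    using S u v by (auto simp: solution_operator_def)
  then have H10: "S u \<in> H10 \<Omega>" "S v \<in> H10 \<Omega>" by (auto simp: weak_solution_def)
  have "weak_solution \<Omega> a c0 (\<lambda>x. s * u x + t * v x) (\<lambda>x. s * S u x + t * S v x)"
    unfolding weak_solution_def
  proof (intro conjI ballI)
    fix w assume w: "w \<in> H10 \<Omega>"
    then have "energy_form \<Omega> a c0 (\<lambda>x. s * S u x + t * S v x) w =
        s * energy_form \<Omega> a c0 (S u) w + t * energy_form \<Omega> a c0 (S v) w"
      by (intro energy_form_lincomb H10_H1 H10)
    also have "\<dots> = L2_inner \<Omega> (\<lambda>x. s * u x + t * v x) w"
      using sol w u v by (simp add: weak_solution_def L2_inner_lincomb H1_L2 H10_H1)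
    finally show "energy_form \<Omega> a c0 (\<lambda>x. s * S u x + t * S v x) w = L2_inner \<Omega> (\<lambda>x. s * u x + t * v x) w" .
  qed (rule H10_lincomb[OF H10])
  then have "AE x in lebesgue_on \<Omega>. s * S u x + t * S v x = S (\<lambda>x. s * u x + t * v x) x"
    using S L2_lincomb[OF u v] by (simp add: solution_operator_def)
  then show ?thesis by eventually_elim simp
qed

text \<open>The value of \<open>S u\<close> at a point depends on all of \<open>u\<close>, so the
  criterion for integrands of the form k (u x) does not apply. The square is instead estimated
  almost everywhere after combining the states.\<close>

lemma tracking_convex:
  assumes S: "solution_operator \<Omega> a c0 S" and g: "g \<in> L2 \<Omega>"
  shows "convex_on (L2 \<Omega>) (\<lambda>u. (L2_norm \<Omega> (S u + g))\<^sup>2)"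
  unfolding convex_on_def
proof (intro conjI convex_L2 ballI allI impI)
  fix u v and s t :: real
  assume uv: "u \<in> L2 \<Omega>" "v \<in> L2 \<Omega>" and st: "0 \<le> s" "0 \<le> t" "s + t = 1"
  have w: "s *\<^sub>R u + t *\<^sub>R v = (\<lambda>x. s * u x + t * v x)"
    by (simp add: fun_eq_iff scaleR_fun_def)
  have L2: "S u + g \<in> L2 \<Omega>" "S v + g \<in> L2 \<Omega>" "S (s *\<^sub>R u + t *\<^sub>R v) + g \<in> L2 \<Omega>"
    unfolding w by (intro L2_add solution_operator_L2[OF S] L2_lincomb uv g)+
  have "AE x in lebesgue_on \<Omega>. (S (s *\<^sub>R u + t *\<^sub>R v) + g) x = s * (S u + g) x + t * (S v + g) x"
    unfolding w using solution_operator_lincomb[OF S uv, of s t]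
  proof eventually_elim
    case (elim x)
    \<comment> \<open>The shift by \<open>g\<close> is only affine; it survives because the weights
      sum to 1.\<close>
    have "g x = s * g x + t * g x" using st(3) by (simp flip: distrib_right)
    with elim show ?case by (simp add: distrib_left)
  qed
  then have "AE x in lebesgue_on \<Omega>. ((S (s *\<^sub>R u + t *\<^sub>R v) + g) x)\<^sup>2 \<le>
      s * ((S u + g) x)\<^sup>2 + t * ((S v + g) x)\<^sup>2"
  proof eventually_elim
    case (elim x)
    show ?case
      unfolding elim using convex_power2 st by (auto simp: convex_on_def)
  qed
  then have "(\<integral>x. ((S (s *\<^sub>R u + t *\<^sub>R v) + g) x)\<^sup>2 \<partial>lebesgue_on \<Omega>) \<le>
      (\<integral>x. s * ((S u + g) x)\<^sup>2 + t * ((S v + g) x)\<^sup>2 \<partial>lebesgue_on \<Omega>)"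
    by (intro integral_mono_AE Bochner_Integration.integrable_add integrable_mult_right
        L2_integrable_power2 L2)
  also have "\<dots> = s * (L2_norm \<Omega> (S u + g))\<^sup>2 + t * (L2_norm \<Omega> (S v + g))\<^sup>2"
    unfolding L2_norm_power2 using L2_integrable_power2[OF L2(1)] L2_integrable_power2[OF L2(2)] by simp
  finally show "(L2_norm \<Omega> (S (s *\<^sub>R u + t *\<^sub>R v) + g))\<^sup>2 \<le>
      s * (L2_norm \<Omega> (S u + g))\<^sup>2 + t * (L2_norm \<Omega> (S v + g))\<^sup>2"
    by (simp only: L2_norm_power2)
qed

end

section \<open>Convexity of the functionals\<close>

lemma L2_norm_power2_convex: "convex_on (L2 \<Omega>) (\<lambda>u. (L2_norm \<Omega> u)\<^sup>2)"
  by (rule convex_on_L2_integral[OF convex_power2]) (auto simp: L2_integrable_power2 L2_norm_power2)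

lemma L1_norm_convex: "convex_on (L2 \<Omega>) (L1_norm \<Omega>)"
proof (rule convex_on_L2_integral)
  show "convex_on UNIV (\<lambda>t::real. \<bar>t\<bar>)"
    using convex_on_dist[of UNIV "0::real"] by (simp add: dist_real_def)
qed (auto simp: L1_norm_def L2_integrable)

text \<open>The difference must be treated under one integral, since convexity belongs to the
  combined integrand. The root is integrable because it is dominated by a multiple of |u|.\<close>

lemma Upsilon_defect_convex:
  assumes p: "p > 1" and \<gamma>: "\<gamma> > 0"
  shows "convex_on (L2 \<Omega>) (\<lambda>u. delta p \<gamma> * L1_norm \<Omega> u - Upsilon \<Omega> p \<gamma> u)"
proof (rule convex_on_L2_integral[OF h_reg_defect_convex(1)[OF p \<gamma>]])
  fix u assume u: "u \<in> L2 \<Omega>"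
  have [measurable]: "u \<in> borel_measurable (lebesgue_on \<Omega>)" using u by (rule L2_measurable)
  have abs: "integrable (lebesgue_on \<Omega>) (\<lambda>x. delta p \<gamma> * \<bar>u x\<bar>)"
    by (intro integrable_mult_right integrable_abs L2_integrable u)
  have ups: "integrable (lebesgue_on \<Omega>) (\<lambda>x. h_reg p \<gamma> (u x) powr (1 / p))"
  proof (rule Bochner_Integration.integrable_bound[OF abs])
    show "(\<lambda>x. h_reg p \<gamma> (u x) powr (1 / p)) \<in> borel_measurable (lebesgue_on \<Omega>)"
      unfolding h_reg_def by measurable
    have "norm (h_reg p \<gamma> (u x) powr (1 / p)) \<le> norm (delta p \<gamma> * \<bar>u x\<bar>)" for x
      using h_reg_defect_convex(2)[OF p \<gamma>, of "u x"] by simp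
    then show "AE x in lebesgue_on \<Omega>. norm (h_reg p \<gamma> (u x) powr (1 / p)) \<le> norm (delta p \<gamma> * \<bar>u x\<bar>)"
      by (intro AE_I2)
  qed
  show "integrable (lebesgue_on \<Omega>) (\<lambda>x. delta p \<gamma> * \<bar>u x\<bar> - h_reg p \<gamma> (u x) powr (1 / p))"
    by (rule Bochner_Integration.integrable_diff[OF abs ups])
  show "delta p \<gamma> * L1_norm \<Omega> u - Upsilon \<Omega> p \<gamma> u =
      (\<integral>x. delta p \<gamma> * \<bar>u x\<bar> - h_reg p \<gamma> (u x) powr (1 / p) \<partial>lebesgue_on \<Omega>)"
    unfolding Bochner_Integration.integral_diff[OF abs ups] by (simp add: L1_norm_def Upsilon_def)
qed

end

theorem lemma5:
  fixes \<Omega> :: "(real^'n) set"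
    and a :: "'n \<Rightarrow> 'n \<Rightarrow> real^'n \<Rightarrow> real"
    and c0 f y_d :: "real^'n \<Rightarrow> real"
    and S :: "(real^'n \<Rightarrow> real) \<Rightarrow> (real^'n \<Rightarrow> real)"
    and p \<alpha> \<beta> \<gamma> \<sigma> :: real
  assumes "CARD('n) = 2 \<or> CARD('n) = 3"
    and "bounded_Lipschitz_domain \<Omega>"
    and "p > 1" and "\<alpha> > 0" and "\<beta> > 0"
    and "f \<in> L2 \<Omega>" and "y_d \<in> L2 \<Omega>"
    and "\<And>i j. \<exists>L. L-lipschitz_on (closure \<Omega>) (a i j)"
    and "c0 \<in> Linfty \<Omega>"
    and "\<And>i j x. x \<in> closure \<Omega> \<Longrightarrow> a i j x = a j i x"
    and "\<sigma> > 0"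
    and "AE x in lebesgue_on \<Omega>. \<forall>\<xi> :: real^'n.
           (\<Sum>i\<in>UNIV. \<Sum>j\<in>UNIV. a i j x * \<xi> $ i * \<xi> $ j) \<ge> \<sigma> * (norm \<xi>)\<^sup>2"
    and "solution_operator \<Omega> a c0 S"
    and "continuous_L2_H1 \<Omega> S"
    and "\<gamma> > 0"
  shows "convex_on (L2 \<Omega>) (\<lambda>u. 1 / 2 * (L2_norm \<Omega> (S u + S f - y_d))\<^sup>2
           + \<alpha> / 2 * (L2_norm \<Omega> u)\<^sup>2 + \<beta> * delta p \<gamma> * L1_norm \<Omega> u)
       \<and> convex_on (L2 \<Omega>) (\<lambda>u. \<beta> * (delta p \<gamma> * L1_norm \<Omega> u - Upsilon \<Omega> p \<gamma> u))"
proof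
  interpret bounded_open \<Omega>
    using assms(2) by unfold_locales (auto simp: bounded_Lipschitz_domain_def)
  have a: "a i j \<in> Linfty \<Omega>" for i j
    using assms(8) Lipschitz_Linfty by blast
  \<comment> \<open>Regrouping isolates the part independent of \<open>u\<close>, which serves as
    the fixed shift \<open>g\<close> in \<open>tracking_convex\<close>.\<close>
  have eq: "S u + S f - y_d = S u + (S f - y_d)" for u
    by (simp add: fun_eq_iff)
  have "S f - y_d \<in> L2 \<Omega>"
    by (intro L2_diff solution_operator_L2[OF a assms(9) assms(13)] assms)
  then have "convex_on (L2 \<Omega>) (\<lambda>u. (L2_norm \<Omega> (S u + S f - y_d))\<^sup>2)"
    unfolding eq by (rule tracking_convex[OF a assms(9) assms(13)])
  moreover have "delta p \<gamma> \<ge> 0"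
    by (simp add: delta_def)
  ultimately show "convex_on (L2 \<Omega>) (\<lambda>u. 1 / 2 * (L2_norm \<Omega> (S u + S f - y_d))\<^sup>2
      + \<alpha> / 2 * (L2_norm \<Omega> u)\<^sup>2 + \<beta> * delta p \<gamma> * L1_norm \<Omega> u)"
    using assms(4,5)
    by (intro convex_on_add convex_on_cmul L2_norm_power2_convex L1_norm_convex) auto
  show "convex_on (L2 \<Omega>) (\<lambda>u. \<beta> * (delta p \<gamma> * L1_norm \<Omega> u - Upsilon \<Omega> p \<gamma> u))"
    using assms(3,5,15) by (intro convex_on_cmul Upsilon_defect_convex) auto
qed

end
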